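(* Let $i\ge 2$ and let $B_{3i}$ be a bouquet with $3i$ edges whose intersection graph $I(B_{3i})$ is the complete tripartite graph $K_{i,i,i}$. Then $$^{\partial}\varepsilon_{B_{3i}}^{\times}(z)=\begin{cases} z^{3i-2}+3z^{2i}\left[(1+z)^{i}-z^i\right]+3z^{i+2}\left[(1+z)^{i}-z^i\right]^2+z^{2}\left[(1+z)^{i}-z^i\right]^3, & \text{if } i \text{ is odd},\\ z^{3i}+3z^{2i}\left[(1+z)^{i}-z^i\right]+3z^{i+2}\left[(1+z)^{i}-z^i\right]^2+z^{2}\left[(1+z)^{i}-z^i\right]^3, & \text{if } i \text{ is even}.\end{cases}$$
   Context: A ribbon graph $G$ is a surface with boundary represented as the union of two finite sets of closed topological discs, vertex-discs $V(G)$ and edge-ribbons $E(G)$, such that: vertex-discs and edge-ribbons intersect in disjoint line segments; each such segment lies on the boundary of precisely one vertex-disc and precisely one edge-ribbon; every edge-ribbon contains exactly two such segments. All graphs are connected (loops and multiple edges allowed). Let $F(G)$ be the set of faces (boundary components of the surface) and $c(G)$ the number of connected components. The Euler genus is $\varepsilon(G)=2c(G)-|V(G)|+|E(G)|-|F(G)|$. For $A\subseteq E(G)$, the partial Petrial $G^{\times|A}$ is obtained by detaching one end of each edge-ribbon in $A$ from its incident vertex-disc, giving the edge a half-twist, and reattaching it. The partial Petrial polynomial is $^{\partial}\varepsilon_G^{\times}(z)=\sum_{A\subseteq E(G)}z^{\varepsilon(G^{\times|A})}$. A bouquet is a ribbon graph with exactly one vertex-disc. Two edges (loops) of a bouquet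 are interlaced if their half-edges alternate in the cyclic order of half-edges around the vertex-disc. The intersection graph $I(B)$ of a bouquet $B$ has the loops of $B$ as vertices, two being adjacent if and only if the loops are interlaced. *)

theory Defs
  imports
    "HOL-Combinatorics.Orbits"
    "HOL-Computational_Algebra.Polynomial"
begin

text \<open>
  A ribbon graph is a surface glued from discs along segments, and it is determined up to
  homeomorphism by the following data.  The boundary circle of every vertex-disc is given an
  (arbitrary) direction; \<open>segs\<close> is the set of line segments in which vertex-discs and
  edge-ribbons meet (the half-edges), \<open>vert_of\<close> and \<open>edge_of\<close> give the unique vertex-disc and
  the unique edge-ribbon a segment lies on, and \<open>rot\<close> sends a segment to the next one along the
  directed boundary of its vertex-disc.  Each segment has an initial and a terminal end.
  A ribbon has two free sides, each running from an end of one of its segments to an end of the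
  other one.  The ribbon belongs to \<open>twisted\<close> if its sides join initial to initial and
  terminal to terminal ends, and otherwise they join initial to terminal ends.
\<close>

record ('v, 'e, 'h) pre_ribbon_graph =
  verts :: "'v set"
  edges :: "'e set"
  segs :: "'h set"
  vert_of :: "'h \<Rightarrow> 'v"
  edge_of :: "'h \<Rightarrow> 'e"
  rot :: "'h \<Rightarrow> 'h"
  twisted :: "'e set"

definition segs_at :: "('v, 'e, 'h) pre_ribbon_graph \<Rightarrow> 'v \<Rightarrow> 'h set" where
  "segs_at G v = {h \<in> segs G. vert_of G h = v}"

locale ribbon_graph =
  fixes G :: "('v, 'e, 'h) pre_ribbon_graph"
  assumes finite_verts: "finite (verts G)"
    and finite_edges: "finite (edges G)"
    and finite_segs: "finite (segs G)"
    and vert_of_segs: "h \<in> segs G \<Longrightarrow> vert_of G h \<in> verts G"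
    and edge_of_segs: "h \<in> segs G \<Longrightarrow> edge_of G h \<in> edges G"
    and two_segs: "e \<in> edges G \<Longrightarrow> card {h \<in> segs G. edge_of G h = e} = 2"
    and cyclic_rot: "v \<in> verts G \<Longrightarrow> segs_at G v \<noteq> {} \<Longrightarrow> cyclic_on (rot G) (segs_at G v)"
    and twisted_edges: "twisted G \<subseteq> edges G"

text \<open>
  The boundary of the surface is assembled from the free arcs on the vertex-discs and the sides of
  the ribbons, both running between ends of segments; \<open>(h, False)\<close> is the initial and
  \<open>(h, True)\<close> the terminal end of \<open>h\<close>.
\<close>

definition seg_ends :: "('v, 'e, 'h) pre_ribbon_graph \<Rightarrow> ('h \<times> bool) set" where
  "seg_ends G = segs G \<times> UNIV"

definition vertex_arcs :: "('v, 'e, 'h) pre_ribbon_graph \<Rightarrow> ('h \<times> bool) rel" where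
  "vertex_arcs G = {((h, True), (rot G h, False)) | h. h \<in> segs G}"

definition ribbon_sides :: "('v, 'e, 'h) pre_ribbon_graph \<Rightarrow> ('h \<times> bool) rel" where
  "ribbon_sides G = {((h, s), (h', s')) | h s h' s'.
     h \<in> segs G \<and> h' \<in> segs G \<and> h \<noteq> h' \<and> edge_of G h = edge_of G h' \<and>
     (s = s' \<longleftrightarrow> edge_of G h \<in> twisted G)}"

definition same_boundary :: "('v, 'e, 'h) pre_ribbon_graph \<Rightarrow> ('h \<times> bool) rel" where
  "same_boundary G = (vertex_arcs G \<union> (vertex_arcs G)\<inverse> \<union> ribbon_sides G)\<^sup>*"

text \<open>A vertex-disc without segments is bounded by a face of its own.\<close>

definition num_faces :: "('v, 'e, 'h) pre_ribbon_graph \<Rightarrow> nat" where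
  "num_faces G = card (seg_ends G // same_boundary G) + card {v \<in> verts G. segs_at G v = {}}"

definition num_components :: "('v, 'e, 'h) pre_ribbon_graph \<Rightarrow> nat" where
  "num_components G = card (verts G //
     {(vert_of G h, vert_of G h') | h h'. h \<in> segs G \<and> h' \<in> segs G \<and> edge_of G h = edge_of G h'}\<^sup>*)"

definition euler_genus :: "('v, 'e, 'h) pre_ribbon_graph \<Rightarrow> int" where
  "euler_genus G = 2 * int (num_components G) - int (card (verts G)) + int (card (edges G))
     - int (num_faces G)"

text \<open>
  Reattaching one end of a ribbon after a half-twist exchanges the two ends of that segment to
  which the sides of the ribbon are glued, and changes nothing else.
\<close>

definition partial_petrial :: "('v, 'e, 'h) pre_ribbon_graph \<Rightarrow> 'e set \<Rightarrow> ('v, 'e, 'h) pre_ribbon_graph"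
  where "partial_petrial G A = G\<lparr>twisted := sym_diff (twisted G) A\<rparr>"

text \<open>The Euler genus is never negative, so \<^const>\<open>nat\<close> only adapts the type of the exponent.\<close>

definition partial_petrial_poly :: "('v, 'e, 'h) pre_ribbon_graph \<Rightarrow> int poly" where
  "partial_petrial_poly G = (\<Sum>A \<in> Pow (edges G). monom 1 (nat (euler_genus (partial_petrial G A))))"

definition bouquet :: "('v, 'e, 'h) pre_ribbon_graph \<Rightarrow> bool" where
  "bouquet B \<longleftrightarrow> ribbon_graph B \<and> card (verts B) = 1"

text \<open>
  The segments \<open>a, b, c, d\<close> of a bouquet are met in this order during a single turn around the
  vertex-disc.
\<close>

definition in_cyclic_order :: "('v, 'e, 'h) pre_ribbon_graph \<Rightarrow> 'h \<Rightarrow> 'h \<Rightarrow> 'h \<Rightarrow> 'h \<Rightarrow> bool" where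
  "in_cyclic_order B a b c d \<longleftrightarrow> (\<exists>k l m. 0 < k \<and> k < l \<and> l < m \<and> m < card (segs B) \<and>
     b = (rot B ^^ k) a \<and> c = (rot B ^^ l) a \<and> d = (rot B ^^ m) a)"

definition interlaced :: "('v, 'e, 'h) pre_ribbon_graph \<Rightarrow> 'e \<Rightarrow> 'e \<Rightarrow> bool" where
  "interlaced B e f \<longleftrightarrow> (\<exists>a\<in>segs B. \<exists>b\<in>segs B. \<exists>c\<in>segs B. \<exists>d\<in>segs B.
     edge_of B a = e \<and> edge_of B c = e \<and> edge_of B b = f \<and> edge_of B d = f \<and>
     in_cyclic_order B a b c d)"

text \<open>A simple graph is given by its vertex set and its set of two-element edges.\<close>

type_synonym 'a simple_graph = "'a set \<times> 'a set set"

definition intersection_graph :: "('v, 'e, 'h) pre_ribbon_graph \<Rightarrow> 'e simple_graph" where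
  "intersection_graph B =
     (edges B, {{e, f} | e f. e \<in> edges B \<and> f \<in> edges B \<and> e \<noteq> f \<and> interlaced B e f})"

definition is_complete_tripartite :: "'a simple_graph \<Rightarrow> nat \<Rightarrow> nat \<Rightarrow> nat \<Rightarrow> bool" where
  "is_complete_tripartite H l m n \<longleftrightarrow> (\<exists>X Y Z.
     finite X \<and> finite Y \<and> finite Z \<and> card X = l \<and> card Y = m \<and> card Z = n \<and>
     X \<inter> Y = {} \<and> X \<inter> Z = {} \<and> Y \<inter> Z = {} \<and>
     H = (X \<union> Y \<union> Z,
          {{x, y} | x y. x \<in> X \<and> y \<in> Y} \<union> {{x, z} | x z. x \<in> X \<and> z \<in> Z} \<union>
          {{y, z} | y z. y \<in> Y \<and> z \<in> Z}))"

end

theory Submission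
  imports Defs
begin

text \<open>
  The Euler genus of a ribbon graph with a single vertex-disc is the rank over the field with two
  elements of a symmetric matrix indexed by the ribbons: the off-diagonal entry at \<open>e\<close>, \<open>f\<close> says
  whether \<open>e\<close> and \<open>f\<close> are interlaced, the diagonal entry at \<open>e\<close> says whether \<open>e\<close> is twisted.
  To see this, colour the boundary of the surface with two colours so that every boundary component
  is monochromatic.  There are \<open>2 ^ F\<close> such colourings for \<open>F\<close> faces.  Walking along the
  boundary circle of the vertex-disc, the colour can only change where a segment is passed, and the
  two segments of a ribbon agree on whether it changes.  So a colouring amounts to
  the colour of one free arc together with a set \<open>x\<close> of ribbons at which the colour changes.  The
  sides of a ribbon \<open>e\<close> are monochromatic if and only if the number of changes strictly between the
  two segments of \<open>e\<close>, plus one if \<open>e\<close> is twisted and lies in \<open>x\<close>, is even.  Ribbons not interlaced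
  with \<open>e\<close> contribute 0 or 2 to this number, hence the condition is exactly that row \<open>e\<close> of the
  matrix annihilates \<open>x\<close>.
  Therefore \<open>2 ^ F\<close> is twice the size of the null space (\<open>two_pow_num_faces\<close>), and the Euler
  formula turns nullity into rank (\<open>euler_genus_eq_rank\<close>).

  Twisting ribbons changes only the diagonal, and as \<open>A\<close> runs through all sets of ribbons the
  diagonal runs once through all sets \<open>T\<close> of ribbons.  So the polynomial is the generating
  function of the ranks of the matrices with the adjacency of the complete tripartite graph off the
  diagonal and an arbitrary diagonal \<open>T\<close>.  Such a row sees a vector only through the
  parities of its restrictions to the three parts (and through its own entry), so the null space
  can be counted parity by parity (\<open>card_looped_tripartite_null_space\<close>).  It turns out
  that the rank depends only on \<open>card T\<close> and on which parts are contained in \<open>T\<close>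
  (\<open>tripartite_rank_nullity\<close>): it is \<open>card T + 2\<close> if at most one part is contained in \<open>T\<close> and \<open>card T\<close>
  if two are, while for \<open>T\<close> the set of all ribbons it depends on the parity of the common size \<open>i\<close>
  of the parts.  In \<open>z ^ card T\<close> a part contained in \<open>T\<close> accounts for a factor \<open>z ^ i\<close>, and the
  other intersections of \<open>T\<close> with that part add up to \<open>(1 + z) ^ i - z ^ i\<close>.  Grouping the sets \<open>T\<close>
  by the number of parts they contain gives the four summands (\<open>sum_power_tripartite_rank\<close>).
\<close>

section \<open>Counting unions of equivalence classes\<close>

text \<open>
  The closed subsets are the unions of classes, and each union determines its classes.  For
  boundary components these subsets are the monochromatic two-colourings; counting them replaces
  the count of classes by the count of solutions of a linear system.
\<close>

lemma card_closed_subsets: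
  assumes "finite V" "R \<subseteq> V \<times> V" "sym R"
  shows "card {S. S \<subseteq> V \<and> R `` S \<subseteq> S} = 2 ^ card (V // R\<^sup>*)"
proof -
  have eq: "equiv UNIV (R\<^sup>*)"
    using assms(3) by (auto intro!: equivI sym_rtrancl refl_rtrancl trans_rtrancl)
  have class_subset: "R\<^sup>* `` {a} \<subseteq> V" if "a \<in> V" for a
  proof
    fix b assume "b \<in> R\<^sup>* `` {a}"
    then have "(a, b) \<in> R\<^sup>*" by simp
    then show "b \<in> V" using that assms(2) by (induction) auto
  qed
  have "bij_betw Union (Pow (V // R\<^sup>*)) {S. S \<subseteq> V \<and> R `` S \<subseteq> S}"
  proof (rule bij_betw_imageI)
    have sub: "P \<subseteq> Q" if P: "P \<subseteq> V // R\<^sup>*" and Q: "Q \<subseteq> V // R\<^sup>*" and "\<Union>P = \<Union>Q" for P Q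
    proof
      fix c assume "c \<in> P"
      then obtain a where a: "c = R\<^sup>* `` {a}" using P by (auto elim: quotientE)
      then have "a \<in> \<Union>Q" using \<open>c \<in> P\<close> that(3) by blast
      then obtain d where "d \<in> Q" "a \<in> d" by blast
      moreover from this obtain b where "d = R\<^sup>* `` {b}" using Q by (auto elim: quotientE)
      ultimately have "d = c" using a equiv_class_eq[OF eq] by auto
      then show "c \<in> Q" using \<open>d \<in> Q\<close> by simp
    qed
    show "inj_on Union (Pow (V // R\<^sup>*))"
      by (rule inj_onI) (use sub in \<open>simp add: set_eq_subset\<close>)
    show "Union ` Pow (V // R\<^sup>*) = {S. S \<subseteq> V \<and> R `` S \<subseteq> S}" (is "?L = ?R")
    proof
      show "?L \<subseteq> ?R"
      proof clarsimp
        fix P assume P: "P \<subseteq> V // R\<^sup>*"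
        have "c \<subseteq> V \<and> R `` c \<subseteq> c" if "c \<in> P" for c
        proof -
          obtain a where "a \<in> V" "c = R\<^sup>* `` {a}" using P \<open>c \<in> P\<close> by (auto elim: quotientE)
          then show ?thesis using class_subset[of a] by (auto intro: rtrancl_into_rtrancl)
        qed
        then show "\<Union>P \<subseteq> V \<and> R `` \<Union>P \<subseteq> \<Union>P" by blast
      qed
      show "?R \<subseteq> ?L"
      proof
        fix S assume S: "S \<in> ?R"
        then have "R\<^sup>* `` S = S" using Image_closed_trancl by blast
        then have "S = \<Union>((\<lambda>a. R\<^sup>* `` {a}) ` S)" by blast
        moreover have "(\<lambda>a. R\<^sup>* `` {a}) ` S \<subseteq> V // R\<^sup>*" using S by (auto intro: quotientI)
        ultimately show "S \<in> ?L" by blast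
      qed
    qed
  qed
  then have "card {S. S \<subseteq> V \<and> R `` S \<subseteq> S} = card (Pow (V // R\<^sup>*))"
    by (simp add: bij_betw_same_card)
  also have "finite (V // R\<^sup>*)"
    using assms(1) by (auto simp: quotient_def)
  ultimately show ?thesis by (simp add: card_Pow)
qed

section \<open>Ribbon graphs with a single vertex-disc\<close>

text \<open>
  A vector over the field with two elements is represented by its support, a subset of the index
  set \<open>V\<close>, and a matrix by the relation that holds at its nonzero entries.
\<close>

definition null_space :: "'a set \<Rightarrow> ('a \<Rightarrow> 'a \<Rightarrow> bool) \<Rightarrow> 'a set set" where
  "null_space V M = {x. x \<subseteq> V \<and> (\<forall>e\<in>V. even (card {f \<in> x. M e f}))}"

definition twisted_interlacement :: "('v, 'e, 'h) pre_ribbon_graph \<Rightarrow> 'e \<Rightarrow> 'e \<Rightarrow> bool" where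
  "twisted_interlacement G e f \<longleftrightarrow> interlaced G e f \<or> e = f \<and> e \<in> twisted G"

definition crossings :: "('v, 'e, 'h) pre_ribbon_graph \<Rightarrow> 'h \<Rightarrow> 'e set \<Rightarrow> nat \<Rightarrow> nat" where
  "crossings G h x m = card {k. k < m \<and> edge_of G ((rot G ^^ k) h) \<in> x}"

definition boundary_steps :: "('v, 'e, 'h) pre_ribbon_graph \<Rightarrow> ('h \<times> bool) rel" where
  "boundary_steps G = vertex_arcs G \<union> (vertex_arcs G)\<inverse> \<union> ribbon_sides G"

text \<open>
  \<open>S\<close> is the set of segment ends of one colour in a two-colouring that is constant along the free
  arcs of the vertex-disc and changes colour precisely at the segments of the ribbons in \<open>x\<close>.  The
  sides of the ribbons are not required to be monochromatic.
\<close>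

definition arc_coloring :: "('v, 'e, 'h) pre_ribbon_graph \<Rightarrow> 'e set \<Rightarrow> ('h \<times> bool) set \<Rightarrow> bool" where
  "arc_coloring G x S \<longleftrightarrow> S \<subseteq> seg_ends G \<and>
     (\<forall>h\<in>segs G. ((h, True) \<in> S \<longleftrightarrow> (rot G h, False) \<in> S) \<and>
       (edge_of G h \<in> x \<longleftrightarrow> ((h, False) \<in> S) \<noteq> ((h, True) \<in> S)))"

locale one_vertex_ribbon_graph = ribbon_graph G
  for G :: "('v, 'e, 'h) pre_ribbon_graph" +
  assumes one_vertex: "card (verts G) = 1"
    and some_edge: "edges G \<noteq> {}"
begin

lemma segs_nonempty: "segs G \<noteq> {}"
proof -
  obtain e where "e \<in> edges G" using some_edge by blast
  then have "card {h \<in> segs G. edge_of G h = e} = 2" by (rule two_segs)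
  then show ?thesis by auto
qed

lemma obtain_vertex:
  obtains v where "verts G = {v}" "segs_at G v = segs G"
proof -
  obtain v where "verts G = {v}" using one_vertex by (auto simp: card_1_singleton_iff)
  moreover from this have "segs_at G v = segs G" using vert_of_segs by (auto simp: segs_at_def)
  ultimately show ?thesis by (rule that)
qed

lemma cyclic_segs: "cyclic_on (rot G) (segs G)"
proof -
  obtain v where "verts G = {v}" "segs_at G v = segs G" by (rule obtain_vertex)
  then show ?thesis using cyclic_rot[of v] segs_nonempty by simp
qed

lemma rot_pow_in_segs: "h \<in> segs G \<Longrightarrow> (rot G ^^ k) h \<in> segs G"
  using cyclic_on_funpow_in[OF cyclic_segs] .

lemma rot_in_segs: "h \<in> segs G \<Longrightarrow> rot G h \<in> segs G"
  using rot_pow_in_segs[of h 1] by simp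

lemma
  assumes "h \<in> segs G"
  shows rot_pow_card: "(rot G ^^ card (segs G)) h = h"
    and bij_betw_rot_pow: "bij_betw (\<lambda>k. (rot G ^^ k) h) {..<card (segs G)} (segs G)"
proof -
  have orb: "segs G = orbit (rot G) h" "h \<in> orbit (rot G) h"
    using cyclic_segs assms by (auto simp: cyclic_on_alldef)
  let ?n = "funpow_dist1 (rot G) h h"
  have img: "segs G = (\<lambda>k. (rot G ^^ k) h) ` {0..<?n}"
    using orbit_conv_funpow_dist1[OF orb(2)] orb(1) by simp
  have inj: "inj_on (\<lambda>k. (rot G ^^ k) h) {0..<?n}"
    using inj_on_funpow_dist1[OF orb(2)] .
  have n: "card (segs G) = ?n" using img card_image[OF inj] by simp
  show "(rot G ^^ card (segs G)) h = h"
    unfolding n by (rule funpow_dist1_prop[OF orb(2)])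
  show "bij_betw (\<lambda>k. (rot G ^^ k) h) {..<card (segs G)} (segs G)"
    unfolding n using img inj by (auto simp: bij_betw_def atLeast0LessThan)
qed

lemma rot_pow_inj:
  assumes "h \<in> segs G" "j < card (segs G)" "k < card (segs G)"
  shows "(rot G ^^ j) h = (rot G ^^ k) h \<longleftrightarrow> j = k"
  using inj_on_eq_iff[OF bij_betw_imp_inj_on[OF bij_betw_rot_pow[OF assms(1)]], of j k] assms(2,3)
  by simp

lemma rot_pow_surj:
  assumes "h \<in> segs G" "h' \<in> segs G"
  obtains k where "k < card (segs G)" "(rot G ^^ k) h = h'"
proof -
  have "h' \<in> (\<lambda>k. (rot G ^^ k) h) ` {..<card (segs G)}"
    using assms(2) by (simp only: bij_betw_imp_surj_on[OF bij_betw_rot_pow[OF assms(1)]])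
  then show ?thesis using that by blast
qed

text \<open>
  Measuring positions by the number of steps from an arbitrary segment \<open>h\<close> allows every ribbon to be
  studied from one of its own segments, so that its first position is always 0.
\<close>

lemma card_positions:
  assumes "h \<in> segs G" "e \<in> edges G"
  shows "card {k. k < card (segs G) \<and> edge_of G ((rot G ^^ k) h) = e} = 2"
proof -
  let ?s = "\<lambda>k. (rot G ^^ k) h"
  let ?P = "{k. k < card (segs G) \<and> edge_of G (?s k) = e}"
  have "inj_on ?s ?P"
    using bij_betw_imp_inj_on[OF bij_betw_rot_pow[OF assms(1)]] by (rule inj_on_subset) auto
  moreover have "?s ` ?P = {h' \<in> segs G. edge_of G h' = e}"
  proof
    show "?s ` ?P \<subseteq> {h' \<in> segs G. edge_of G h' = e}"
      using rot_pow_in_segs[OF assms(1)] by auto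
    show "{h' \<in> segs G. edge_of G h' = e} \<subseteq> ?s ` ?P"
    proof
      fix h' assume "h' \<in> {h' \<in> segs G. edge_of G h' = e}"
      then show "h' \<in> ?s ` ?P"
        using rot_pow_surj[OF assms(1), of h'] by (metis (mono_tags, lifting) image_eqI mem_Collect_eq)
    qed
  qed
  ultimately show ?thesis
    using two_segs[OF assms(2)] card_image by fastforce
qed

lemma in_cyclic_order_rotate:
  assumes "a \<in> segs G" "in_cyclic_order G a b c d"
  shows "in_cyclic_order G b c d a"
proof -
  obtain k l m where klm: "0 < k" "k < l" "l < m" "m < card (segs G)"
    "b = (rot G ^^ k) a" "c = (rot G ^^ l) a" "d = (rot G ^^ m) a"
    using assms(2) unfolding in_cyclic_order_def by blast
  have shift: "(rot G ^^ j) a = (rot G ^^ (j - k)) b" if "k \<le> j" for j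
  proof -
    have "(rot G ^^ (j - k + k)) a = (rot G ^^ (j - k)) ((rot G ^^ k) a)"
      by (simp only: funpow_add comp_apply)
    moreover have "j - k + k = j" using that by simp
    ultimately show ?thesis by (simp only: klm(5))
  qed
  have le: "k \<le> l" "k \<le> m" "k \<le> card (segs G)" using klm(1-4) by simp_all
  have "c = (rot G ^^ (l - k)) b" by (simp only: klm(6) shift[OF le(1)])
  moreover have "d = (rot G ^^ (m - k)) b" by (simp only: klm(7) shift[OF le(2)])
  moreover have "a = (rot G ^^ (card (segs G) - k)) b"
    using shift[OF le(3)] by (simp only: rot_pow_card[OF assms(1)])
  moreover have "0 < l - k" "l - k < m - k" "m - k < card (segs G) - k" "card (segs G) - k < card (segs G)"
    using klm(1-4) by simp_all
  ultimately show ?thesis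
    unfolding in_cyclic_order_def by blast
qed

lemma interlaced_sym:
  assumes "interlaced G e f"
  shows "interlaced G f e"
proof -
  obtain a b c d where *: "a \<in> segs G" "b \<in> segs G" "c \<in> segs G" "d \<in> segs G"
    "edge_of G a = e" "edge_of G b = f" "edge_of G c = e" "edge_of G d = f"
    "in_cyclic_order G a b c d"
    using assms unfolding interlaced_def by blast
  then show ?thesis
    unfolding interlaced_def using in_cyclic_order_rotate[OF *(1) *(9)] by blast
qed

lemma not_interlaced_self: "\<not> interlaced G e e"
proof
  assume "interlaced G e e"
  then obtain a b c d where abcd: "a \<in> segs G" "edge_of G a = e" "edge_of G b = e"
    "edge_of G c = e" "in_cyclic_order G a b c d"
    unfolding interlaced_def by blast
  then obtain k l where kl: "0 < k" "k < l" "l < card (segs G)"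
    "edge_of G ((rot G ^^ k) a) = e" "edge_of G ((rot G ^^ l) a) = e"
    unfolding in_cyclic_order_def by (metis less_trans)
  have "card {0, k, l} \<le> card {j. j < card (segs G) \<and> edge_of G ((rot G ^^ j) a) = e}"
    by (rule card_mono) (use kl abcd(2) in auto)
  moreover have "e \<in> edges G" using abcd(1,2) edge_of_segs by auto
  ultimately show False using card_positions[OF abcd(1)] kl by simp
qed

text \<open>
  The two segments of \<open>e\<close> cut the boundary circle into two open arcs.  If \<open>e\<close> and \<open>f\<close> differ, \<open>f\<close>
  has two segments in these arcs, and it is interlaced with \<open>e\<close> precisely if the arcs contain one
  each.
\<close>

lemma odd_between_iff_interlaced:
  assumes h: "h \<in> segs G" and e: "edge_of G h = e"
    and p: "0 < p" "p < card (segs G)" "edge_of G ((rot G ^^ p) h) = e"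
    and f: "f \<in> edges G"
  shows "odd (card {k. 0 < k \<and> k < p \<and> edge_of G ((rot G ^^ k) h) = f}) \<longleftrightarrow> interlaced G e f"
proof -
  let ?s = "\<lambda>k. (rot G ^^ k) h"
  let ?N = "card (segs G)"
  let ?P = "\<lambda>f. {k. k < ?N \<and> edge_of G (?s k) = f}"
  let ?B = "{k. 0 < k \<and> k < p \<and> edge_of G (?s k) = f}"
  have e_edge: "e \<in> edges G" using h e edge_of_segs by auto
  have "{0, p} = ?P e"
    by (rule card_subset_eq) (use card_positions[OF h e_edge] p e in auto)
  then have at_e: "k = 0 \<or> k = p" if "k < ?N" "edge_of G (?s k) = e" for k
    using that by blast
  show ?thesis
  proof (cases "e = f")
    case True
    then have "?B = {}" using at_e p(2) less_trans by blast
    then have "even (card ?B)" by (simp only: card.empty even_zero)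
    moreover have "\<not> interlaced G e f" using not_interlaced_self True by simp
    ultimately show ?thesis by blast
  next
    case False
    obtain q' r' where "?P f = {q', r'}" "q' \<noteq> r'"
      using card_positions[OF h f] unfolding card_2_iff by blast
    then obtain q r where Pf: "?P f = {q, r}" "q < r"
      by (metis insert_commute linorder_neqE_nat)
    have "q \<in> ?P f" "r \<in> ?P f" unfolding Pf(1) by simp_all
    then have qr: "q < ?N" "r < ?N" "edge_of G (?s q) = f" "edge_of G (?s r) = f"
      by simp_all
    have at_f: "k = q \<or> k = r" if "k < ?N" "edge_of G (?s k) = f" for k
      using that Pf(1) by blast
    have ne: "q \<noteq> 0" "q \<noteq> p" "r \<noteq> p"
    proof -
      have "q \<noteq> 0" using qr(3) False e by (metis funpow_0)
      then show "q \<noteq> 0" "q \<noteq> p" "r \<noteq> p" using qr p(3) False by auto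
    qed
    have oddB: "odd (card ?B) \<longleftrightarrow> q < p \<and> p < r"
    proof -
      have "?B = (if q < p then {q} else {}) \<union> (if r < p then {r} else {})"
      proof (rule set_eqI)
        fix k
        have "k \<in> ?B \<longleftrightarrow> k < p \<and> (k = q \<or> k = r)"
        proof
          assume "k \<in> ?B"
          then show "k < p \<and> (k = q \<or> k = r)" using at_f[of k] p(2) by simp
        next
          assume "k < p \<and> (k = q \<or> k = r)"
          then show "k \<in> ?B" using qr(3,4) ne Pf(2) by auto
        qed
        then show "k \<in> ?B \<longleftrightarrow> k \<in> (if q < p then {q} else {}) \<union> (if r < p then {r} else {})"
          by auto
      qed
      then show ?thesis using ne Pf(2) by auto
    qed
    have "interlaced G e f" if "q < p" "p < r"
    proof -
      have "in_cyclic_order G h (?s q) (?s p) (?s r)"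
        unfolding in_cyclic_order_def using that ne qr by blast
      then show ?thesis
        unfolding interlaced_def using h e qr p(3) rot_pow_in_segs[OF h] by blast
    qed
    moreover have "q < p \<and> p < r" if ef: "interlaced G e f"
    proof -
      obtain a b c d where *: "a \<in> segs G" "b \<in> segs G" "c \<in> segs G" "d \<in> segs G"
        "edge_of G a = e" "edge_of G b = f" "edge_of G c = e" "edge_of G d = f"
        "in_cyclic_order G a b c d"
        using ef unfolding interlaced_def by blast
      have "in_cyclic_order G c d a b"
        using in_cyclic_order_rotate[OF \<open>b \<in> segs G\<close> in_cyclic_order_rotate[OF \<open>a \<in> segs G\<close> *(9)]] .
      moreover have "h = a \<or> h = c"
      proof -
        obtain j where j: "j < ?N" "?s j = a" using rot_pow_surj[OF h *(1)] .
        obtain k where k: "k < ?N" "?s k = c" using rot_pow_surj[OF h *(3)] .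
        obtain k' l m where "0 < k'" "k' < l" "l < m" "m < ?N" "c = (rot G ^^ l) a"
          using *(9) unfolding in_cyclic_order_def by blast
        then have l: "0 < l" "l < ?N" "c = (rot G ^^ l) a" by simp_all
        have "a \<noteq> c"
          using l rot_pow_inj[OF *(1), of 0 l] by auto
        then have "j \<noteq> k" using j k by blast
        moreover have "j = 0 \<or> j = p" "k = 0 \<or> k = p" using at_e j k *(5,7) by blast+
        ultimately have "j = 0 \<or> k = 0" by auto
        then show ?thesis using j(2) k(2) by auto
      qed
      ultimately have "\<exists>b c d. edge_of G b = f \<and> edge_of G d = f \<and> edge_of G c = e
          \<and> in_cyclic_order G h b c d"
        using *(5-9) by blast
      then obtain k l m where klm: "0 < k" "k < l" "l < m" "m < ?N"
        "edge_of G (?s k) = f" "edge_of G (?s m) = f" "edge_of G (?s l) = e"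
        unfolding in_cyclic_order_def by blast
      then have "l = 0 \<or> l = p" "k = q \<or> k = r" "m = q \<or> m = r"
        using at_e[of l] at_f[of k] at_f[of m] by simp_all
      then show ?thesis using klm Pf(2) by auto
    qed
    ultimately show ?thesis using oddB by blast
  qed
qed

section \<open>Faces and the null space of the twisted interlacement matrix\<close>

lemma odd_between_iff_odd_interlaced:
  assumes h: "h \<in> segs G" and e: "edge_of G h = e"
    and p: "0 < p" "p < card (segs G)" "edge_of G ((rot G ^^ p) h) = e"
    and x: "x \<subseteq> edges G"
  shows "odd (card {k. 0 < k \<and> k < p \<and> edge_of G ((rot G ^^ k) h) \<in> x})
    \<longleftrightarrow> odd (card {f \<in> x. interlaced G e f})"
proof -
  let ?B = "\<lambda>f. {k. 0 < k \<and> k < p \<and> edge_of G ((rot G ^^ k) h) = f}"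
  have fin: "finite x" using x finite_edges finite_subset by blast
  have "{k. 0 < k \<and> k < p \<and> edge_of G ((rot G ^^ k) h) \<in> x} = (\<Union>f\<in>x. ?B f)" by blast
  also have "card \<dots> = (\<Sum>f\<in>x. card (?B f))"
    by (rule card_UN_disjoint) (use fin in auto)
  finally have "odd (card {k. 0 < k \<and> k < p \<and> edge_of G ((rot G ^^ k) h) \<in> x})
      \<longleftrightarrow> odd (card {f \<in> x. odd (card (?B f))})"
    using even_sum_iff[OF fin, of "\<lambda>f. card (?B f)"] by simp
  also have "{f \<in> x. odd (card (?B f))} = {f \<in> x. interlaced G e f}"
    using odd_between_iff_interlaced[OF h e p] x by blast
  finally show ?thesis .
qed

lemma crossings_0 [simp]: "crossings G h x 0 = 0"
  by (simp add: crossings_def)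

lemma crossings_Suc:
  "crossings G h x (Suc m) = crossings G h x m + of_bool (edge_of G ((rot G ^^ m) h) \<in> x)"
proof -
  have "{k. k < Suc m \<and> edge_of G ((rot G ^^ k) h) \<in> x} = {k. k < m \<and> edge_of G ((rot G ^^ k) h) \<in> x}
      \<union> (if edge_of G ((rot G ^^ m) h) \<in> x then {m} else {})"
    by (auto simp: less_Suc_eq)
  then show ?thesis by (auto simp: crossings_def)
qed

text \<open>
  A full turn passes both segments of every ribbon, which is why a colouring with prescribed changes
  closes up after the turn.
\<close>

lemma crossings_total_even:
  assumes "h \<in> segs G" "x \<subseteq> edges G"
  shows "even (crossings G h x (card (segs G)))"
proof -
  let ?P = "\<lambda>f. {k. k < card (segs G) \<and> edge_of G ((rot G ^^ k) h) = f}"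
  have fin: "finite x" using assms(2) finite_edges finite_subset by blast
  have "{k. k < card (segs G) \<and> edge_of G ((rot G ^^ k) h) \<in> x} = (\<Union>f\<in>x. ?P f)" by blast
  also have "card \<dots> = (\<Sum>f\<in>x. card (?P f))"
    by (rule card_UN_disjoint) (use fin in auto)
  also have "\<dots> = (\<Sum>f\<in>x. 2)"
    by (rule sum.cong) (use assms card_positions in auto)
  finally show ?thesis by (simp add: crossings_def)
qed

lemma crossings_between:
  assumes h: "h \<in> segs G" and e: "edge_of G h = e"
    and p: "0 < p" "p < card (segs G)" "edge_of G ((rot G ^^ p) h) = e"
    and x: "x \<subseteq> edges G"
  shows "even (crossings G h x p) \<longleftrightarrow> even (of_bool (e \<in> x) + card {f \<in> x. interlaced G e f})"
proof -
  let ?B = "{k. 0 < k \<and> k < p \<and> edge_of G ((rot G ^^ k) h) \<in> x}"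
  \<comment> \<open>the walk passes the segment of \<open>e\<close> at position 0, but not the one at position \<open>p\<close>\<close>
  have split: "{k. k < p \<and> edge_of G ((rot G ^^ k) h) \<in> x} = ?B \<union> (if e \<in> x then {0} else {})"
    using p(1) e by (auto intro: gr0I)
  have "finite ?B" by (rule finite_subset[of _ "{..<p}"]) auto
  then have "crossings G h x p = of_bool (e \<in> x) + card ?B"
    unfolding crossings_def split by (cases "e \<in> x") simp_all
  then show ?thesis using odd_between_iff_odd_interlaced[OF h e p x] by simp
qed

lemma arc_coloring_segs: "arc_coloring G x S \<Longrightarrow> (h, t) \<in> S \<Longrightarrow> h \<in> segs G"
  by (auto simp: arc_coloring_def seg_ends_def)

lemma arc_coloring_arc:
  "arc_coloring G x S \<Longrightarrow> h \<in> segs G \<Longrightarrow> (rot G h, False) \<in> S \<longleftrightarrow> (h, True) \<in> S"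
  by (simp add: arc_coloring_def)

lemma arc_coloring_jump:
  "arc_coloring G x S \<Longrightarrow> h \<in> segs G \<Longrightarrow>
    edge_of G h \<in> x \<longleftrightarrow> ((h, False) \<in> S) \<noteq> ((h, True) \<in> S)"
  by (simp add: arc_coloring_def)

lemma arc_coloring_walk:
  assumes S: "arc_coloring G x S" and h: "h \<in> segs G"
  shows "((rot G ^^ m) h, False) \<in> S \<longleftrightarrow> ((h, False) \<in> S) = even (crossings G h x m)"
proof (induction m)
  case (Suc m)
  let ?g = "(rot G ^^ m) h"
  have g: "?g \<in> segs G" by (rule rot_pow_in_segs[OF h])
  show ?case
    using Suc arc_coloring_arc[OF S g] arc_coloring_jump[OF S g] by (auto simp: crossings_Suc)
qed simp

lemma card_twisted_row:
  assumes "x \<subseteq> edges G"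
  shows "card {f \<in> x. twisted_interlacement G e f}
    = of_bool (e \<in> x \<and> e \<in> twisted G) + card {f \<in> x. interlaced G e f}"
proof -
  have "finite x" using assms finite_edges finite_subset by blast
  moreover have "{f \<in> x. twisted_interlacement G e f}
      = {f \<in> x. interlaced G e f} \<union> (if e \<in> x \<and> e \<in> twisted G then {e} else {})"
    by (auto simp: twisted_interlacement_def)
  ultimately show ?thesis using not_interlaced_self[of e] by auto
qed

text \<open>
  If \<open>h\<close> and \<open>h'\<close> are the segments of \<open>e\<close>, the walk from \<open>h\<close> to \<open>h'\<close> compares the colours of their
  initial ends.  For a twisted ribbon these have to agree, which makes the number of changes
  at \<open>h\<close> and strictly between \<open>h\<close> and \<open>h'\<close> even.  For an untwisted ribbon the initial end of \<open>h\<close>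
  is compared with the terminal end of \<open>h'\<close>, and the changes at \<open>h\<close> and \<open>h'\<close> cancel.  In both
  cases the condition for the other side is the same, since the colour changes at both
  segments or at neither.
\<close>

lemma arc_coloring_sides_iff:
  assumes S: "arc_coloring G x S" and x: "x \<subseteq> edges G"
  shows "ribbon_sides G `` S \<subseteq> S \<longleftrightarrow> x \<in> null_space (edges G) (twisted_interlacement G)"
proof -
  have row: "(\<forall>a\<in>segs G. \<forall>b\<in>segs G. \<forall>s. edge_of G a = e \<and> edge_of G b = e \<and> a \<noteq> b \<longrightarrow> (a, s) \<in> S \<longrightarrow>
       (b, s = (e \<in> twisted G)) \<in> S) \<longleftrightarrow> even (card {f \<in> x. twisted_interlacement G e f})"
    if e: "e \<in> edges G" for e
  proof -
    obtain h h' where hh': "{h \<in> segs G. edge_of G h = e} = {h, h'}" "h \<noteq> h'"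
      using two_segs[OF e] unfolding card_2_iff by blast
    then have h: "h \<in> segs G" "edge_of G h = e" "h' \<in> segs G" "edge_of G h' = e"
      by blast+
    have only: "a = h \<or> a = h'" if "a \<in> segs G" "edge_of G a = e" for a
      using that hh' by blast
    obtain p where p: "p < card (segs G)" "(rot G ^^ p) h = h'"
      using rot_pow_surj[OF h(1,3)] .
    then have "0 < p" using hh'(2) by (intro gr0I) auto
    have walk: "(h', False) \<in> S \<longleftrightarrow>
        ((h, False) \<in> S) = even (of_bool (e \<in> x) + card {f \<in> x. interlaced G e f})"
      using arc_coloring_walk[OF S h(1), of p] crossings_between[OF h(1,2) \<open>0 < p\<close> p(1) _ x] p(2) h(4)
      by simp
    have jump: "e \<in> x \<longleftrightarrow> ((h, False) \<in> S) \<noteq> ((h, True) \<in> S)" "e \<in> x \<longleftrightarrow> ((h', False) \<in> S) \<noteq> ((h', True) \<in> S)"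
      using arc_coloring_jump[OF S h(1)] arc_coloring_jump[OF S h(3)] h(2,4) by simp_all
    have "(\<forall>a\<in>segs G. \<forall>b\<in>segs G. \<forall>s. edge_of G a = e \<and> edge_of G b = e \<and> a \<noteq> b \<longrightarrow> (a, s) \<in> S \<longrightarrow>
       (b, s = (e \<in> twisted G)) \<in> S) \<longleftrightarrow>
       (\<forall>s. (h, s) \<in> S \<longleftrightarrow> (h', s = (e \<in> twisted G)) \<in> S)" (is "?l = ?r")
    proof
      assume l: ?l
      have fw: "(h', s = (e \<in> twisted G)) \<in> S" if "(h, s) \<in> S" for s
        using l[rule_format, OF h(1,3) _ that] h hh'(2) by simp
      have bw: "(h, s = (e \<in> twisted G)) \<in> S" if "(h', s) \<in> S" for s
        using l[rule_format, OF h(3,1) _ that] h hh'(2) by simp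
      show ?r
      proof (intro allI iffI)
        fix s assume "(h', s = (e \<in> twisted G)) \<in> S"
        then have "(h, (s = (e \<in> twisted G)) = (e \<in> twisted G)) \<in> S" by (rule bw)
        moreover have "((s = (e \<in> twisted G)) = (e \<in> twisted G)) = s" by blast
        ultimately show "(h, s) \<in> S" by (simp only:)
      qed (rule fw)
    next
      assume r: ?r
      have r': "(h', s) \<in> S \<longleftrightarrow> (h, s = (e \<in> twisted G)) \<in> S" for s
        using r[rule_format, of "s = (e \<in> twisted G)"] by (cases "e \<in> twisted G"; cases s) simp_all
      show ?l
      proof (intro ballI allI impI)
        fix a b s
        assume ab: "a \<in> segs G" "b \<in> segs G" "edge_of G a = e \<and> edge_of G b = e \<and> a \<noteq> b"
          and "(a, s) \<in> S"
        then consider "a = h" "b = h'" | "a = h'" "b = h" using only by blast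
        then show "(b, s = (e \<in> twisted G)) \<in> S"
          by cases (use \<open>(a, s) \<in> S\<close> r[rule_format, of s] r'[of s] in simp_all)
      qed
    qed
    also have "\<dots> \<longleftrightarrow> even (card {f \<in> x. twisted_interlacement G e f})"
    proof -
      \<comment> \<open>\<open>a0\<close>, \<open>a1\<close> and \<open>b0\<close>, \<open>b1\<close> are the colours at the initial and terminal ends of \<open>h\<close> and \<open>h'\<close>,
        and \<open>c\<close> says that evenly many ribbons of \<open>x\<close> are interlaced with \<open>e\<close>\<close>
      have taut: "(a1 = (if t then b1 else b0)) \<and> (a0 = (if t then b0 else b1)) \<longleftrightarrow> c = (\<not> (X \<and> t))"
        if "b0 = (a0 = (c = (\<not> X)))" "X = (a0 \<noteq> a1)" "X = (b0 \<noteq> b1)" for a0 a1 b0 b1 t c X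
        using that by argo
      have parity: "even (of_bool b + n) = (even n = (\<not> b))" for b and n :: nat
        by (cases b) simp_all
      have "(\<forall>s. ((h, s) \<in> S) = ((h', s = t) \<in> S)) \<longleftrightarrow>
          ((h, True) \<in> S) = (if t then (h', True) \<in> S else (h', False) \<in> S) \<and>
          ((h, False) \<in> S) = (if t then (h', False) \<in> S else (h', True) \<in> S)" for t
        by (cases t) (simp_all add: all_bool_eq)
      then show ?thesis
        using taut[OF walk[unfolded parity] jump]
        unfolding card_twisted_row[OF x] parity by (simp only:)
    qed
    finally show ?thesis .
  qed
  have "ribbon_sides G `` S \<subseteq> S \<longleftrightarrow>
    (\<forall>e\<in>edges G. \<forall>a\<in>segs G. \<forall>b\<in>segs G. \<forall>s. edge_of G a = e \<and> edge_of G b = e \<and> a \<noteq> b \<longrightarrow>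
       (a, s) \<in> S \<longrightarrow> (b, s = (e \<in> twisted G)) \<in> S)" (is "?l = ?r")
  proof
    assume l: ?l
    show ?r
    proof (intro ballI allI impI)
      fix e a b s assume *: "a \<in> segs G" "b \<in> segs G" "edge_of G a = e \<and> edge_of G b = e \<and> a \<noteq> b" "(a, s) \<in> S"
      then have "((a, s), (b, s = (e \<in> twisted G))) \<in> ribbon_sides G"
        unfolding ribbon_sides_def by (cases s) auto
      then show "(b, s = (e \<in> twisted G)) \<in> S" using l *(4) by blast
    qed
  next
    assume r: ?r
    show ?l
    proof
      fix y assume "y \<in> ribbon_sides G `` S"
      then obtain a b s s' where *: "a \<in> segs G" "b \<in> segs G" "a \<noteq> b" "edge_of G a = edge_of G b"
        "(s = s') = (edge_of G a \<in> twisted G)" "(a, s) \<in> S" "y = (b, s')"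
        unfolding ribbon_sides_def by blast
      have "s' = (s = (edge_of G a \<in> twisted G))" using *(5) by blast
      then show "y \<in> S"
        using r[rule_format, OF edge_of_segs[OF *(1)] *(1,2) _ *(6)] *(3,4,7) by simp
    qed
  qed
  also have "\<dots> \<longleftrightarrow> x \<in> null_space (edges G) (twisted_interlacement G)"
    using row x by (simp add: null_space_def)
  finally show ?thesis .
qed

text \<open>
  The colours are dictated by the parity of the changes passed on the way from \<open>h\<close>.
\<close>

lemma arc_coloring_exists:
  assumes h: "h \<in> segs G" and x: "x \<subseteq> edges G"
  obtains S where "arc_coloring G x S" "(h, False) \<in> S \<longleftrightarrow> b"
proof -
  let ?s = "\<lambda>k. (rot G ^^ k) h"
  let ?N = "card (segs G)"
  define S where "S = {(?s k, t) | k t. k < ?N \<and> b = even (crossings G h x (k + of_bool t))}"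
  have mem: "(?s k, t) \<in> S \<longleftrightarrow> b = even (crossings G h x (k + of_bool t))" if "k < ?N" for k t
    using that rot_pow_inj[OF h] unfolding S_def by blast
  have N: "0 < ?N" using segs_nonempty finite_segs by (simp add: card_gt_0_iff)
  have "((a, True) \<in> S \<longleftrightarrow> (rot G a, False) \<in> S) \<and>
       (edge_of G a \<in> x \<longleftrightarrow> ((a, False) \<in> S) \<noteq> ((a, True) \<in> S))" if "a \<in> segs G" for a
  proof -
    obtain k where k: "k < ?N" "?s k = a" using rot_pow_surj[OF h \<open>a \<in> segs G\<close>] .
    have "(?s (Suc k), False) \<in> S \<longleftrightarrow> b = even (crossings G h x (Suc k))"
    \<comment> \<open>at the last position the walk returns to position 0, where the parity has to match\<close>
    proof (cases "Suc k = ?N")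
      case True
      have "?s ?N = ?s 0" using rot_pow_card[OF h] by simp
      then show ?thesis
        using mem[OF N, of False] crossings_total_even[OF h x] unfolding True by simp
    next
      case False
      then show ?thesis using mem[of "Suc k" False] k(1) by simp
    qed
    then show ?thesis using mem[OF k(1)] k(2) by (auto simp: crossings_Suc)
  qed
  moreover have "S \<subseteq> seg_ends G"
    using rot_pow_in_segs[OF h] by (auto simp: S_def seg_ends_def)
  ultimately have "arc_coloring G x S" by (simp add: arc_coloring_def)
  moreover have "(h, False) \<in> S \<longleftrightarrow> b" using mem[OF N, of False] by simp
  ultimately show ?thesis by (rule that)
qed

lemma arc_coloring_unique:
  assumes h: "h \<in> segs G" and S: "arc_coloring G x S" and S': "arc_coloring G x S'"
    and eq: "(h, False) \<in> S \<longleftrightarrow> (h, False) \<in> S'"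
  shows "S = S'"
proof -
  have init: "(a, False) \<in> S \<longleftrightarrow> (a, False) \<in> S'" if "a \<in> segs G" for a
  proof -
    obtain k where "(rot G ^^ k) h = a" using rot_pow_surj[OF h \<open>a \<in> segs G\<close>] .
    then show ?thesis
      using arc_coloring_walk[OF S h, of k] arc_coloring_walk[OF S' h, of k] eq by simp
  qed
  have "(a, t) \<in> S \<longleftrightarrow> (a, t) \<in> S'" if "a \<in> segs G" for a t
    using init[OF that] arc_coloring_jump[OF S that] arc_coloring_jump[OF S' that]
    by (cases t) auto
  then show ?thesis
    using arc_coloring_segs[OF S] arc_coloring_segs[OF S'] by auto
qed

text \<open>
  The only candidate for the set of ribbons at which \<open>S\<close> changes colour.  For arbitrary \<open>S\<close> the two
  segments of a ribbon may disagree on the change; the existential quantifier then decides in favour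
  of it.
\<close>

definition jumps :: "('h \<times> bool) set \<Rightarrow> 'e set" where
  "jumps S = {e \<in> edges G. \<exists>h\<in>segs G. edge_of G h = e \<and> ((h, False) \<in> S) \<noteq> ((h, True) \<in> S)}"

lemma arc_coloring_jumps:
  assumes "arc_coloring G x S" "x \<subseteq> edges G"
  shows "jumps S = x"
proof -
  have "e \<in> jumps S \<longleftrightarrow> e \<in> x" if e: "e \<in> edges G" for e
  proof -
    have "{h \<in> segs G. edge_of G h = e} \<noteq> {}" using two_segs[OF e] by force
    then obtain h where "h \<in> segs G" "edge_of G h = e" by blast
    moreover have "((h, False) \<in> S) \<noteq> ((h, True) \<in> S) \<longleftrightarrow> e \<in> x" if "h \<in> segs G" "edge_of G h = e" for h
      using arc_coloring_jump[OF assms(1) that(1)] that(2) by simp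
    ultimately show ?thesis using e unfolding jumps_def by auto
  qed
  moreover have "jumps S \<subseteq> edges G" by (auto simp: jumps_def)
  ultimately show ?thesis using assms(2) by blast
qed

text \<open>
  Whether or not a ribbon is twisted, its sides pair the two ends of one segment with the two ends of
  the other.  Hence, if the sides are monochromatic, the ends of one segment differ precisely if
  the ends of the other one do.
\<close>

lemma closed_imp_arc_coloring:
  assumes "S \<subseteq> seg_ends G" and closed: "boundary_steps G `` S \<subseteq> S"
  shows "arc_coloring G (jumps S) S"
proof -
  have step: "p \<in> S \<Longrightarrow> (p, q) \<in> boundary_steps G \<Longrightarrow> q \<in> S" for p q
    using closed by blast
  have arc: "(h, True) \<in> S \<longleftrightarrow> (rot G h, False) \<in> S" if "h \<in> segs G" for h
  proof -
    have "((h, True), (rot G h, False)) \<in> vertex_arcs G"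
      using that by (auto simp: vertex_arcs_def)
    then show ?thesis using step unfolding boundary_steps_def by blast
  qed
  have side: "(a, s) \<in> S \<longleftrightarrow> (b, s = (edge_of G a \<in> twisted G)) \<in> S"
    if "a \<in> segs G" "b \<in> segs G" "a \<noteq> b" "edge_of G a = edge_of G b" for a b s
  proof -
    have "((a, s), (b, s = (edge_of G a \<in> twisted G))) \<in> ribbon_sides G"
      "((b, s = (edge_of G a \<in> twisted G)), (a, s)) \<in> ribbon_sides G"
      unfolding ribbon_sides_def using that by auto
    then show ?thesis using step unfolding boundary_steps_def by blast
  qed
  have "edge_of G a \<in> jumps S \<longleftrightarrow> ((a, False) \<in> S) \<noteq> ((a, True) \<in> S)" if a: "a \<in> segs G" for a
  proof
    assume "edge_of G a \<in> jumps S"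
    then have "\<exists>b\<in>segs G. edge_of G b = edge_of G a \<and> ((b, False) \<in> S) \<noteq> ((b, True) \<in> S)"
      unfolding jumps_def by blast
    then obtain b where b: "b \<in> segs G" "edge_of G a = edge_of G b" "((b, False) \<in> S) \<noteq> ((b, True) \<in> S)"
      by metis
    show "((a, False) \<in> S) \<noteq> ((a, True) \<in> S)"
    proof (cases "a = b")
      case False
      from side[OF a b(1) this b(2), of False] side[OF a b(1) this b(2), of True]
      show ?thesis using b(3) by (cases "edge_of G a \<in> twisted G") auto
    qed (use b in simp)
  next
    assume "((a, False) \<in> S) \<noteq> ((a, True) \<in> S)"
    then show "edge_of G a \<in> jumps S" using a edge_of_segs unfolding jumps_def by blast
  qed
  then show ?thesis using assms(1) arc unfolding arc_coloring_def by blast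
qed

lemma closed_iff_arc_coloring:
  "S \<subseteq> seg_ends G \<and> boundary_steps G `` S \<subseteq> S \<longleftrightarrow>
    jumps S \<in> null_space (edges G) (twisted_interlacement G) \<and> arc_coloring G (jumps S) S"
proof -
  have sub: "jumps S \<subseteq> edges G" by (auto simp: jumps_def)
  have split: "boundary_steps G `` S \<subseteq> S \<longleftrightarrow>
      (vertex_arcs G \<union> (vertex_arcs G)\<inverse>) `` S \<subseteq> S \<and> ribbon_sides G `` S \<subseteq> S"
    unfolding boundary_steps_def by blast
  have "(vertex_arcs G \<union> (vertex_arcs G)\<inverse>) `` S \<subseteq> S" "S \<subseteq> seg_ends G" if "arc_coloring G (jumps S) S"
    using that unfolding arc_coloring_def vertex_arcs_def by auto
  then show ?thesis
    using arc_coloring_sides_iff[OF _ sub] closed_imp_arc_coloring split by blast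
qed

text \<open>
  A monochromatic colouring of the boundary components corresponds to the colour of one free arc,
  which accounts for the factor 2, and a vector in the null space.
\<close>

theorem two_pow_num_faces:
  "2 ^ num_faces G = 2 * card (null_space (edges G) (twisted_interlacement G))"
proof -
  let ?K = "null_space (edges G) (twisted_interlacement G)"
  let ?C = "{S. S \<subseteq> seg_ends G \<and> boundary_steps G `` S \<subseteq> S}"
  obtain h where h: "h \<in> segs G" using segs_nonempty by blast
  have sub: "x \<subseteq> edges G" if "x \<in> ?K" for x
    using that by (simp add: null_space_def)
  have "bij_betw (\<lambda>S. ((h, False) \<in> S, jumps S)) ?C (UNIV \<times> ?K)"
  proof (rule bij_betw_imageI)
    show "inj_on (\<lambda>S. ((h, False) \<in> S, jumps S)) ?C"
    proof (rule inj_onI)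
      fix S S' assume "S \<in> ?C" "S' \<in> ?C"
        and "((h, False) \<in> S, jumps S) = ((h, False) \<in> S', jumps S')"
      then have "arc_coloring G (jumps S) S" "arc_coloring G (jumps S) S'"
        "(h, False) \<in> S \<longleftrightarrow> (h, False) \<in> S'"
        unfolding closed_iff_arc_coloring by simp_all
      then show "S = S'" by (rule arc_coloring_unique[OF h])
    qed
    show "(\<lambda>S. ((h, False) \<in> S, jumps S)) ` ?C = UNIV \<times> ?K"
    proof
      show "(\<lambda>S. ((h, False) \<in> S, jumps S)) ` ?C \<subseteq> UNIV \<times> ?K"
        unfolding closed_iff_arc_coloring by auto
      show "UNIV \<times> ?K \<subseteq> (\<lambda>S. ((h, False) \<in> S, jumps S)) ` ?C"
      proof clarify
        fix b x assume x: "x \<in> ?K"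
        obtain S where S: "arc_coloring G x S" "(h, False) \<in> S \<longleftrightarrow> b"
          using arc_coloring_exists[OF h sub[OF x]] .
        moreover have "jumps S = x" using arc_coloring_jumps[OF S(1) sub[OF x]] .
        ultimately show "(b, x) \<in> (\<lambda>S. ((h, False) \<in> S, jumps S)) ` ?C"
          unfolding closed_iff_arc_coloring using x by auto
      qed
    qed
  qed
  then have "card ?C = 2 * card ?K"
    by (simp add: bij_betw_same_card card_cartesian_product)
  moreover have "card ?C = 2 ^ card (seg_ends G // (boundary_steps G)\<^sup>*)"
  proof (rule card_closed_subsets)
    show "finite (seg_ends G)" using finite_segs by (simp add: seg_ends_def)
    show "boundary_steps G \<subseteq> seg_ends G \<times> seg_ends G"
      using rot_in_segs
      by (auto simp: boundary_steps_def vertex_arcs_def ribbon_sides_def seg_ends_def)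
    show "sym (boundary_steps G)"
      unfolding boundary_steps_def by (rule symI) (auto simp: ribbon_sides_def)
  qed
  moreover have "num_faces G = card (seg_ends G // (boundary_steps G)\<^sup>*)"
  proof -
    obtain v where "verts G = {v}" "segs_at G v = segs G" by (rule obtain_vertex)
    then have no_isolated: "{v \<in> verts G. segs_at G v = {}} = {}" using segs_nonempty by auto
    show ?thesis
      unfolding num_faces_def no_isolated same_boundary_def boundary_steps_def by simp
  qed
  ultimately show ?thesis by simp
qed

text \<open>
  The hypothesis says that \<open>r\<close> is the rank of the twisted interlacement matrix, in the form of the
  rank-nullity theorem.
\<close>

theorem euler_genus_eq_rank:
  assumes "card (null_space (edges G) (twisted_interlacement G)) * 2 ^ r = 2 ^ card (edges G)"
  shows "euler_genus G = int r"
proof -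
  obtain v where v: "verts G = {v}" by (rule obtain_vertex)
  have "num_components G = 1"
    unfolding num_components_def v by (simp add: singleton_quotient)
  moreover have "(2::nat) ^ (num_faces G + r) = 2 ^ (card (edges G) + 1)"
    using assms two_pow_num_faces by (simp add: power_add)
  then have "num_faces G + r = card (edges G) + 1"
    using power_inject_exp[of "2::nat" "num_faces G + r" "card (edges G) + 1"] by simp
  ultimately show ?thesis unfolding euler_genus_def v by simp
qed

end

section \<open>The nullity of a complete tripartite graph with loops\<close>

definition looped_tripartite :: "'a set \<Rightarrow> 'a set \<Rightarrow> 'a set \<Rightarrow> 'a set \<Rightarrow> 'a \<Rightarrow> 'a \<Rightarrow> bool" where
  "looped_tripartite X Y Z T e f \<longleftrightarrow> e \<in> X \<and> f \<in> Y \<union> Z \<or> e \<in> Y \<and> f \<in> X \<union> Z \<or> e \<in> Z \<and> f \<in> X \<union> Y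
    \<or> e = f \<and> e \<in> T"

lemma null_space_cong:
  assumes "\<And>e f. e \<in> V \<Longrightarrow> f \<in> V \<Longrightarrow> M e f \<longleftrightarrow> M' e f"
  shows "null_space V M = null_space V M'"
proof -
  have "{f \<in> x. M e f} = {f \<in> x. M' e f}" if "x \<subseteq> V" "e \<in> V" for x e
    using assms that by blast
  then show ?thesis unfolding null_space_def by auto
qed

lemma card_subsets_of_parity:
  assumes "finite U" "U \<noteq> {}"
  shows "card {a. a \<subseteq> U \<and> odd (card a) = p} = 2 ^ (card U - 1)"
proof -
  let ?n = "\<lambda>p. card {a. a \<subseteq> U \<and> odd (card a) = p}"
  have "{} \<subset> U" using assms(2) by blast
  then have "?n False = ?n True"
    using card_subsupersets_even_odd[OF assms(1), of "{}"] by simp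
  moreover have "?n True + ?n False = card (Pow U)"
    by (subst card_Un_disjoint[symmetric]) (use assms(1) in \<open>auto intro!: arg_cong[where f = card]\<close>)
  moreover have "(2::nat) * 2 ^ (card U - 1) = card (Pow U)"
    using assms by (simp add: card_Pow card_gt_0_iff flip: power_Suc)
  ultimately show ?thesis by (cases p) simp_all
qed

text \<open>
  The possible restrictions \<open>a\<close> of a null vector to a part \<open>X\<close> of a complete multipartite graph with
  loops at \<open>T\<close>, if the restriction has parity \<open>p\<close> and the sum of all entries outside of \<open>X\<close> is \<open>w\<close>:
  the row of a vertex \<open>v\<close> consists of the entries outside of \<open>X\<close> and, if there is a loop, of
  the diagonal entry at \<open>v\<close>.
\<close>

definition part_solutions :: "'a set \<Rightarrow> 'a set \<Rightarrow> bool \<Rightarrow> bool \<Rightarrow> 'a set set" where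
  "part_solutions X T p w = {a. a \<subseteq> X \<and> odd (card a) = p \<and> (\<forall>v\<in>X. w = (v \<in> T \<and> v \<in> a))}"

text \<open>
  At a vertex with a loop the entry is forced to be \<open>w\<close>.  At a vertex without a loop \<open>w\<close> has to
  vanish and the entry is free; if there is such a vertex, half of the free choices have parity \<open>p\<close>.
\<close>

lemma card_part_solutions:
  assumes "finite X"
  shows "card (part_solutions X T p w) =
    (if X \<subseteq> T then of_bool (p = (w \<and> odd (card X))) else of_bool (\<not> w) * 2 ^ (card (X - T) - 1))"
proof (cases "X \<subseteq> T")
  case True
  have "part_solutions X T p w = (if p = (w \<and> odd (card X)) then {if w then X else {}} else {})"
  proof -
    have "a \<subseteq> X \<and> (\<forall>v\<in>X. w = (v \<in> T \<and> v \<in> a)) \<longleftrightarrow> a = (if w then X else {})" for a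
      using True by (cases w) auto
    then have "part_solutions X T p w = {a. a = (if w then X else {}) \<and> odd (card a) = p}"
      unfolding part_solutions_def by blast
    then show ?thesis by auto
  qed
  then show ?thesis using True by simp
next
  case False
  then obtain v where v: "v \<in> X" "v \<notin> T" by blast
  show ?thesis
  proof (cases w)
    case True
    then have "part_solutions X T p w = {}" using v unfolding part_solutions_def by blast
    then show ?thesis using True False by simp
  next
    case w: False
    have "part_solutions X T p w = {a. a \<subseteq> X - T \<and> odd (card a) = p}"
      using w unfolding part_solutions_def by blast
    then show ?thesis
      using card_subsets_of_parity[of "X - T" p] assms v False w by auto
  qed
qed

lemma row_parity:
  assumes "finite (X \<union> Y \<union> Z)" "x \<subseteq> X \<union> Y \<union> Z" "e \<in> X"
    and "X \<inter> Y = {}" "X \<inter> Z = {}" "Y \<inter> Z = {}"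
    and row: "\<And>f. M f \<longleftrightarrow> f \<in> Y \<or> f \<in> Z \<or> e = f \<and> e \<in> T"
  shows "even (card {f \<in> x. M f}) \<longleftrightarrow>
    (odd (card (x \<inter> Y)) \<noteq> odd (card (x \<inter> Z))) = (e \<in> T \<and> e \<in> x \<inter> X)"
proof -
  let ?l = "if e \<in> T \<and> e \<in> x then {e} else {}"
  have fin: "finite (x \<inter> Y)" "finite (x \<inter> Z)" using assms(1) by auto
  have "{f \<in> x. M f} = (x \<inter> Y) \<union> (x \<inter> Z) \<union> ?l" using row by auto
  also have "card \<dots> = card ((x \<inter> Y) \<union> (x \<inter> Z)) + card ?l"
    by (rule card_Un_disjoint) (use fin assms(3-6) in auto)
  also have "card ((x \<inter> Y) \<union> (x \<inter> Z)) = card (x \<inter> Y) + card (x \<inter> Z)"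
    by (rule card_Un_disjoint) (use fin assms(6) in auto)
  finally have "card {f \<in> x. M f} = card (x \<inter> Y) + card (x \<inter> Z) + card ?l" .
  then show ?thesis using assms(3) by auto
qed

lemma looped_tripartite_null_space_iff:
  assumes "finite (X \<union> Y \<union> Z)" "X \<inter> Y = {}" "X \<inter> Z = {}" "Y \<inter> Z = {}"
  defines "par \<equiv> \<lambda>x P. odd (card (x \<inter> P))"
  shows "x \<in> null_space (X \<union> Y \<union> Z) (looped_tripartite X Y Z T) \<longleftrightarrow> x \<subseteq> X \<union> Y \<union> Z \<and>
     x \<inter> X \<in> part_solutions X T (par x X) (par x Y \<noteq> par x Z) \<and>
     x \<inter> Y \<in> part_solutions Y T (par x Y) (par x X \<noteq> par x Z) \<and>
     x \<inter> Z \<in> part_solutions Z T (par x Z) (par x X \<noteq> par x Y)"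
proof (cases "x \<subseteq> X \<union> Y \<union> Z")
  case True
  let ?M = "looped_tripartite X Y Z T"
  have "even (card {f \<in> x. ?M e f}) \<longleftrightarrow> (par x Y \<noteq> par x Z) = (e \<in> T \<and> e \<in> x \<inter> X)" if "e \<in> X" for e
    unfolding par_def
    by (rule row_parity[of X Y Z]) (use assms(1-4) True that in \<open>auto simp: looped_tripartite_def\<close>)
  moreover have "even (card {f \<in> x. ?M e f}) \<longleftrightarrow> (par x X \<noteq> par x Z) = (e \<in> T \<and> e \<in> x \<inter> Y)" if "e \<in> Y" for e
    unfolding par_def
    by (rule row_parity[of Y X Z]) (use assms(1-4) True that in \<open>auto simp: looped_tripartite_def\<close>)
  moreover have "even (card {f \<in> x. ?M e f}) \<longleftrightarrow> (par x X \<noteq> par x Y) = (e \<in> T \<and> e \<in> x \<inter> Z)" if "e \<in> Z" for e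
    unfolding par_def
    by (rule row_parity[of Z X Y]) (use assms(1-4) True that in \<open>auto simp: looped_tripartite_def\<close>)
  ultimately show ?thesis
    using True by (simp add: null_space_def part_solutions_def ball_Un par_def)
qed (simp add: null_space_def)

text \<open>
  The parities \<open>p\<close>, \<open>q\<close>, \<open>r\<close> of a vector on the three parts decouple the parts: once they are fixed,
  the restrictions to the parts can be chosen independently.
\<close>

lemma card_looped_tripartite_null_space:
  assumes fin: "finite (X \<union> Y \<union> Z)" and disj: "X \<inter> Y = {}" "X \<inter> Z = {}" "Y \<inter> Z = {}"
  shows "card (null_space (X \<union> Y \<union> Z) (looped_tripartite X Y Z T)) =
    (\<Sum>p\<in>UNIV. \<Sum>q\<in>UNIV. \<Sum>r\<in>UNIV. card (part_solutions X T p (q \<noteq> r)) *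
       (card (part_solutions Y T q (p \<noteq> r)) * card (part_solutions Z T r (p \<noteq> q))))"
proof -
  let ?K = "null_space (X \<union> Y \<union> Z) (looped_tripartite X Y Z T)"
  let ?par = "\<lambda>x P. odd (card (x \<inter> P))"
  let ?S = "\<lambda>(p, q, r). part_solutions X T p (q \<noteq> r) \<times> part_solutions Y T q (p \<noteq> r) \<times> part_solutions Z T r (p \<noteq> q)"
  have "bij_betw (\<lambda>x. ((?par x X, ?par x Y, ?par x Z), (x \<inter> X, x \<inter> Y, x \<inter> Z))) ?K (Sigma UNIV ?S)"
  proof (rule bij_betwI[where g = "\<lambda>(_, a, b, c). a \<union> b \<union> c"])
    show "(\<lambda>x. ((?par x X, ?par x Y, ?par x Z), (x \<inter> X, x \<inter> Y, x \<inter> Z))) \<in> ?K \<rightarrow> Sigma UNIV ?S"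
      using looped_tripartite_null_space_iff[OF assms] by auto
    have parts: "a \<subseteq> X" "b \<subseteq> Y" "c \<subseteq> Z" "(a \<union> b \<union> c) \<inter> X = a" "(a \<union> b \<union> c) \<inter> Y = b" "(a \<union> b \<union> c) \<inter> Z = c"
      "odd (card a) = p" "odd (card b) = q" "odd (card c) = r"
      if "a \<in> part_solutions X T p u" "b \<in> part_solutions Y T q v" "c \<in> part_solutions Z T r w"
      for a b c p q r u v w
      using that disj by (auto simp: part_solutions_def)
    show "(\<lambda>(_, a, b, c). a \<union> b \<union> c) \<in> Sigma UNIV ?S \<rightarrow> ?K"
    proof clarsimp
      fix p q r a b c
      assume abc: "a \<in> part_solutions X T p (q = (\<not> r))" "b \<in> part_solutions Y T q (p = (\<not> r))"
        "c \<in> part_solutions Z T r (p = (\<not> q))"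
      note P = parts[OF abc]
      show "a \<union> b \<union> c \<in> ?K"
        unfolding looped_tripartite_null_space_iff[OF assms] P(4-9) using abc P(1-3) by auto
    qed
    show "(\<lambda>(_, a, b, c). a \<union> b \<union> c) ((?par x X, ?par x Y, ?par x Z), (x \<inter> X, x \<inter> Y, x \<inter> Z)) = x"
      if "x \<in> ?K" for x
      using that by (auto simp: null_space_def)
    show "(\<lambda>x. ((?par x X, ?par x Y, ?par x Z), (x \<inter> X, x \<inter> Y, x \<inter> Z))) ((\<lambda>(_, a, b, c). a \<union> b \<union> c) s) = s"
      if "s \<in> Sigma UNIV ?S" for s
    proof -
      obtain p q r a b c where s: "s = ((p, q, r), (a, b, c))" by (metis surj_pair)
      then have abc: "a \<in> part_solutions X T p (q \<noteq> r)" "b \<in> part_solutions Y T q (p \<noteq> r)"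
        "c \<in> part_solutions Z T r (p \<noteq> q)"
        using that by auto
      show ?thesis unfolding s using parts[OF abc] by simp
    qed
  qed
  then have "card ?K = card (Sigma UNIV ?S)" by (rule bij_betw_same_card)
  also have "\<dots> = (\<Sum>s\<in>UNIV. card (?S s))"
  proof (rule card_SigmaI)
    have "finite (part_solutions P T p w)" if "finite P" for P p w
      using that by (simp add: part_solutions_def)
    then show "\<forall>s\<in>UNIV. finite (?S s)" using fin by auto
  qed simp
  also have "\<dots> = (\<Sum>(p, q, r)\<in>UNIV \<times> UNIV \<times> UNIV. card (part_solutions X T p (q \<noteq> r)) *
       (card (part_solutions Y T q (p \<noteq> r)) * card (part_solutions Z T r (p \<noteq> q))))"
    by (simp add: card_cartesian_product case_prod_beta)
  finally show ?thesis
    by (simp add: sum.cartesian_product)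
qed

text \<open>
  The rank of the adjacency matrix of the complete tripartite graph with parts \<open>X\<close>, \<open>Y\<close>, \<open>Z\<close> of size
  \<open>i\<close> and a loop at each vertex of \<open>T\<close>.  If there are loops everywhere, a null vector is constant on
  each part; it vanishes for even \<open>i\<close>, while for odd \<open>i\<close> the three constants are only required
  to have sum 0, which leaves a null space of dimension 2.
\<close>

definition tripartite_rank :: "nat \<Rightarrow> 'a set \<Rightarrow> 'a set \<Rightarrow> 'a set \<Rightarrow> 'a set \<Rightarrow> nat" where
  "tripartite_rank i X Y Z T =
    (if X \<subseteq> T \<and> Y \<subseteq> T \<and> Z \<subseteq> T then if odd i then 3 * i - 2 else 3 * i
     else card T + (if X \<subseteq> T \<and> Y \<subseteq> T \<or> X \<subseteq> T \<and> Z \<subseteq> T \<or> Y \<subseteq> T \<and> Z \<subseteq> T then 0 else 2))"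

text \<open>
  Evaluating the sum over the eight triples of parities in each of the eight cases for which parts
  are contained in \<open>T\<close>.  With \<open>u\<close> the number of vertices without a loop, the nullity is \<open>u - 2\<close> if at
  most one part is contained in \<open>T\<close>, and \<open>u\<close> if exactly two parts are.
\<close>

lemma tripartite_rank_nullity:
  assumes fin: "finite (X \<union> Y \<union> Z)" and disj: "X \<inter> Y = {}" "X \<inter> Z = {}" "Y \<inter> Z = {}"
    and card: "card X = i" "card Y = i" "card Z = i" and i: "i > 0" and T: "T \<subseteq> X \<union> Y \<union> Z"
  shows "card (null_space (X \<union> Y \<union> Z) (looped_tripartite X Y Z T)) * 2 ^ tripartite_rank i X Y Z T
    = 2 ^ (3 * i)"
proof -
  have finP: "finite X" "finite Y" "finite Z" using fin by auto
  have cards: "card T = card (T \<inter> X) + card (T \<inter> Y) + card (T \<inter> Z)"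
  proof -
    have "T = (T \<inter> X) \<union> (T \<inter> Y) \<union> (T \<inter> Z)" using T by blast
    also have "card \<dots> = card ((T \<inter> X) \<union> (T \<inter> Y)) + card (T \<inter> Z)"
      by (rule card_Un_disjoint) (use finP disj in auto)
    also have "card ((T \<inter> X) \<union> (T \<inter> Y)) = card (T \<inter> X) + card (T \<inter> Y)"
      by (rule card_Un_disjoint) (use finP disj in auto)
    finally show ?thesis .
  qed
  have split: "card (T \<inter> P) + card (P - T) = i \<and> (P \<subseteq> T \<longrightarrow> card (P - T) = 0)
      \<and> (\<not> P \<subseteq> T \<longrightarrow> (\<exists>u. card (P - T) = Suc u))"
    if "finite P" "card P = i" for P
  proof -
    have "card (T \<inter> P) + card (P - T) = card ((T \<inter> P) \<union> (P - T))"
      by (rule card_Un_disjoint[symmetric]) (use that in auto)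
    also have "(T \<inter> P) \<union> (P - T) = P" by blast
    finally have "card (T \<inter> P) + card (P - T) = i" using that by simp
    moreover have "\<exists>u. card (P - T) = Suc u" if "\<not> P \<subseteq> T"
      using that \<open>finite P\<close> by (metis Diff_eq_empty_iff card_eq_0_iff finite_Diff not0_implies_Suc)
    moreover have "card (P - T) = 0" if "P \<subseteq> T" using that by (metis Diff_eq_empty_iff card.empty)
    ultimately show ?thesis by blast
  qed
  obtain a a' b b' c c' where abc: "card (T \<inter> X) = a" "card (X - T) = a'" "card (T \<inter> Y) = b"
    "card (Y - T) = b'" "card (T \<inter> Z) = c" "card (Z - T) = c'" by blast
  have sX: "a + a' = i" "X \<subseteq> T \<Longrightarrow> a' = 0" "\<not> X \<subseteq> T \<Longrightarrow> \<exists>u. a' = Suc u"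
    and sY: "b + b' = i" "Y \<subseteq> T \<Longrightarrow> b' = 0" "\<not> Y \<subseteq> T \<Longrightarrow> \<exists>u. b' = Suc u"
    and sZ: "c + c' = i" "Z \<subseteq> T \<Longrightarrow> c' = 0" "\<not> Z \<subseteq> T \<Longrightarrow> \<exists>u. c' = Suc u"
    using split[OF finP(1) card(1)] split[OF finP(2) card(2)] split[OF finP(3) card(3)]
    unfolding abc by auto
  let ?k = "card (null_space (X \<union> Y \<union> Z) (looped_tripartite X Y Z T))"
  note K = card_looped_tripartite_null_space[OF fin disj, of T, unfolded UNIV_bool,
      unfolded card_part_solutions[OF finP(1)] card_part_solutions[OF finP(2)] card_part_solutions[OF finP(3)]
        card abc, simplified]
  note R = tripartite_rank_def[of i X Y Z T, unfolded cards abc]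
  have pow: "(2::nat) ^ n * 2 ^ m = 2 ^ l" if "n + m = l" for n m l
    using that by (simp flip: power_add)
  show ?thesis
  proof (cases "X \<subseteq> T"; cases "Y \<subseteq> T"; cases "Z \<subseteq> T")
    assume *: "X \<subseteq> T" "Y \<subseteq> T" "Z \<subseteq> T"
    show ?thesis
    proof (cases "odd i")
      case True
      then have "?k = 2 ^ 2" using K * by simp
      then show ?thesis using R * True i by (simp only: simp_thms if_True) (rule pow, cases i, auto)
    next
      case False
      then have "?k = 1" using K * by simp
      then show ?thesis using R * False by simp
    qed
  next
    assume *: "X \<subseteq> T" "Y \<subseteq> T" "\<not> Z \<subseteq> T"
    have "?k = 2 ^ c'" using K * sZ by (cases "odd i") auto
    then show ?thesis using R * sX sY sZ by (simp only: simp_thms if_True if_False) (rule pow, auto)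
  next
    assume *: "X \<subseteq> T" "\<not> Y \<subseteq> T" "Z \<subseteq> T"
    have "?k = 2 ^ b'" using K * sY by (cases "odd i") auto
    then show ?thesis using R * sX sY sZ by (simp only: simp_thms if_True if_False) (rule pow, auto)
  next
    assume *: "\<not> X \<subseteq> T" "Y \<subseteq> T" "Z \<subseteq> T"
    have "?k = 2 ^ a'" using K * sX by (cases "odd i") auto
    then show ?thesis using R * sX sY sZ by (simp only: simp_thms if_True if_False) (rule pow, auto)
  next
    assume *: "X \<subseteq> T" "\<not> Y \<subseteq> T" "\<not> Z \<subseteq> T"
    have "?k = 2 ^ (b' - 1 + (c' - 1))" using K * by (simp add: power_add)
    then show ?thesis using R * sX sY sZ by (simp only: simp_thms if_True if_False) (rule pow, auto)
  next
    assume *: "\<not> X \<subseteq> T" "Y \<subseteq> T" "\<not> Z \<subseteq> T"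
    have "?k = 2 ^ (a' - 1 + (c' - 1))" using K * by (simp add: power_add)
    then show ?thesis using R * sX sY sZ by (simp only: simp_thms if_True if_False) (rule pow, auto)
  next
    assume *: "\<not> X \<subseteq> T" "\<not> Y \<subseteq> T" "Z \<subseteq> T"
    have "?k = 2 ^ (a' - 1 + (b' - 1))" using K * by (simp add: power_add)
    then show ?thesis using R * sX sY sZ by (simp only: simp_thms if_True if_False) (rule pow, auto)
  next
    assume *: "\<not> X \<subseteq> T" "\<not> Y \<subseteq> T" "\<not> Z \<subseteq> T"
    have "?k = 2 ^ (1 + (a' - 1) + (b' - 1) + (c' - 1))" using K * by (simp add: power_add)
    then show ?thesis using R * sX sY sZ by (simp only: simp_thms if_True if_False) (rule pow, auto)
  qed
qed

section \<open>The generating function of the ranks\<close>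

lemma sum_Pow_Un_disjoint:
  assumes "X \<inter> Y = {}"
  shows "(\<Sum>T\<in>Pow (X \<union> Y). g T) = (\<Sum>A\<in>Pow X. \<Sum>B\<in>Pow Y. g (A \<union> B))"
proof -
  have "(\<Sum>T\<in>Pow (X \<union> Y). g T) = (\<Sum>(A, B)\<in>Pow X \<times> Pow Y. g (A \<union> B))"
  proof (rule sum.reindex_bij_witness[where i = "\<lambda>(A, B). A \<union> B" and j = "\<lambda>T. (T \<inter> X, T \<inter> Y)"])
    fix T assume "T \<in> Pow (X \<union> Y)"
    then have "T \<inter> X \<union> T \<inter> Y = T" by blast
    then show "(case (T \<inter> X, T \<inter> Y) of (A, B) \<Rightarrow> A \<union> B) = T"
      "(case (T \<inter> X, T \<inter> Y) of (A, B) \<Rightarrow> g (A \<union> B)) = g T" by simp_all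
  next
    fix p assume p: "p \<in> Pow X \<times> Pow Y"
    then show "(case p of (A, B) \<Rightarrow> A \<union> B) \<in> Pow (X \<union> Y)" by auto
    show "((case p of (A, B) \<Rightarrow> A \<union> B) \<inter> X, (case p of (A, B) \<Rightarrow> A \<union> B) \<inter> Y) = p"
      using p assms by (cases p) auto
  qed auto
  then show ?thesis by (simp add: sum.cartesian_product)
qed

lemma sum_Pow_power_card:
  fixes z :: "'b::comm_ring_1"
  assumes "finite X"
  shows "(\<Sum>A\<in>Pow X. z ^ card A) = (1 + z) ^ card X"
  using prod_add[OF assms, of "\<lambda>_. z" "\<lambda>_. 1"] by (simp add: add.commute)

text \<open>
  Summation over the subsets of one part if the summand depends on whether the whole part was chosen:
  the weight \<open>z ^ card X\<close> of the top element is left to \<open>g\<close>.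
\<close>

lemma sum_Pow_top_separated:
  fixes z :: "'b::comm_ring_1"
  assumes "finite X"
  shows "(\<Sum>A\<in>Pow X. (if A = X then 1 else z ^ card A) * g (A = X))
    = g True + g False * ((1 + z) ^ card X - z ^ card X)"
proof -
  have fin: "finite (Pow X)" using assms by simp
  have "(\<Sum>A\<in>Pow X. (if A = X then 1 else z ^ card A) * g (A = X))
      = g True + (\<Sum>A\<in>Pow X - {X}. z ^ card A * g False)"
    by (subst sum.remove[OF fin, of X]) (auto intro!: sum.cong)
  also have "(\<Sum>A\<in>Pow X - {X}. z ^ card A * g False) = g False * (\<Sum>A\<in>Pow X - {X}. z ^ card A)"
    by (simp add: sum_distrib_left mult.commute)
  also have "(\<Sum>A\<in>Pow X - {X}. z ^ card A) = (1 + z) ^ card X - z ^ card X"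
    using sum.remove[OF fin, of X "\<lambda>A. z ^ card A"] sum_Pow_power_card[OF assms, of z]
    by (simp add: algebra_simps)
  finally show ?thesis .
qed

lemma sum_power_tripartite_rank:
  fixes z :: "'b::comm_ring_1"
  assumes fin: "finite (X \<union> Y \<union> Z)" and disj: "X \<inter> Y = {}" "X \<inter> Z = {}" "Y \<inter> Z = {}"
    and card: "card X = i" "card Y = i" "card Z = i"
  defines "P \<equiv> (1 + z) ^ i - z ^ i"
  shows "(\<Sum>T\<in>Pow (X \<union> Y \<union> Z). z ^ tripartite_rank i X Y Z T) =
    z ^ (if odd i then 3 * i - 2 else 3 * i) + 3 * z ^ (2 * i) * P + 3 * z ^ (i + 2) * P ^ 2 + z ^ 2 * P ^ 3"
proof -
  have finP: "finite X" "finite Y" "finite Z" using fin by auto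
  \<comment> \<open>the factor of \<open>z ^ rank\<close> that remains when every part not contained in \<open>T\<close> has
    contributed its elements of \<open>T\<close>; the arguments say which parts are contained in \<open>T\<close>\<close>
  define W where "W a b c = (if a \<and> b \<and> c then z ^ (if odd i then 3 * i - 2 else 3 * i)
     else if a \<and> b \<or> a \<and> c \<or> b \<and> c then z ^ (2 * i)
     else if a \<or> b \<or> c then z ^ (i + 2) else z ^ 2)" for a b c
  let ?t = "\<lambda>X A. if A = X then 1 else z ^ card A"
  note top = sum_Pow_top_separated[OF finP(1), of z, unfolded card, folded P_def]
    sum_Pow_top_separated[OF finP(2), of z, unfolded card, folded P_def]
    sum_Pow_top_separated[OF finP(3), of z, unfolded card, folded P_def]
  have summand: "z ^ tripartite_rank i X Y Z (A \<union> B \<union> C)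
      = ?t X A * (?t Y B * (?t Z C * W (A = X) (B = Y) (C = Z)))"
    if "A \<subseteq> X" "B \<subseteq> Y" "C \<subseteq> Z" for A B C
  proof -
    have full: "X \<subseteq> A \<union> B \<union> C \<longleftrightarrow> A = X" "Y \<subseteq> A \<union> B \<union> C \<longleftrightarrow> B = Y" "Z \<subseteq> A \<union> B \<union> C \<longleftrightarrow> C = Z"
      using that disj by blast+
    have finA: "finite A" "finite B" "finite C" using that finP finite_subset by blast+
    have "card (A \<union> B \<union> C) = card (A \<union> B) + card C"
      by (rule card_Un_disjoint) (use finA that disj in auto)
    also have "card (A \<union> B) = card A + card B"
      by (rule card_Un_disjoint) (use finA that disj in auto)
    finally have cards: "card (A \<union> B \<union> C) = card A + card B + card C" .
    have double: "z ^ (2 * i) = z ^ i * z ^ i" "z ^ (i * 2) = z ^ i * z ^ i"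
      by (simp_all add: power_add mult_2 mult_2_right)
    show ?thesis
      unfolding tripartite_rank_def full cards W_def
      by (cases "A = X"; cases "B = Y"; cases "C = Z")
        (simp_all add: card power_add double ac_simps power2_eq_square)
  qed
  have "(\<Sum>T\<in>Pow (X \<union> Y \<union> Z). z ^ tripartite_rank i X Y Z T)
      = (\<Sum>A\<in>Pow X. \<Sum>B\<in>Pow Y. \<Sum>C\<in>Pow Z. z ^ tripartite_rank i X Y Z (A \<union> B \<union> C))"
    using disj by (simp add: sum_Pow_Un_disjoint Int_Un_distrib2)
  also have "\<dots> = (\<Sum>A\<in>Pow X. \<Sum>B\<in>Pow Y. \<Sum>C\<in>Pow Z.
      ?t X A * (?t Y B * (?t Z C * W (A = X) (B = Y) (C = Z))))"
    by (intro sum.cong refl summand) auto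
  also have "\<dots> = (\<Sum>A\<in>Pow X. ?t X A * (\<Sum>B\<in>Pow Y. ?t Y B * (\<Sum>C\<in>Pow Z. ?t Z C * W (A = X) (B = Y) (C = Z))))"
    by (simp only: sum_distrib_left)
  also have "\<dots> = (\<Sum>A\<in>Pow X. ?t X A * (\<Sum>B\<in>Pow Y. ?t Y B * (W (A = X) (B = Y) True + W (A = X) (B = Y) False * P)))"
    by (simp only: top(3)[of "W (A = X) (B = Y)" for A B])
  also have "\<dots> = (\<Sum>A\<in>Pow X. ?t X A * (W (A = X) True True + W (A = X) True False * P
      + (W (A = X) False True + W (A = X) False False * P) * P))"
    by (simp only: top(2)[of "\<lambda>b. W (A = X) b True + W (A = X) b False * P" for A])
  also have "\<dots> = W True True True + W True True False * P + (W True False True + W True False False * P) * P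
      + (W False True True + W False True False * P + (W False False True + W False False False * P) * P) * P"
    by (simp only: top(1)[of "\<lambda>a. W a True True + W a True False * P + (W a False True + W a False False * P) * P"])
  also have "\<dots> = z ^ (if odd i then 3 * i - 2 else 3 * i) + 3 * z ^ (2 * i) * P + 3 * z ^ (i + 2) * P ^ 2 + z ^ 2 * P ^ 3"
    by (simp add: W_def algebra_simps power2_eq_square power3_eq_cube)
  finally show ?thesis .
qed

section \<open>Partial Petrials of bouquets with complete tripartite intersection graph\<close>

lemma interlaced_partial_petrial: "interlaced (partial_petrial G A) = interlaced G"
  by (intro ext) (simp add: interlaced_def in_cyclic_order_def partial_petrial_def)

lemma one_vertex_partial_petrial:
  assumes "one_vertex_ribbon_graph G" "A \<subseteq> edges G"
  shows "one_vertex_ribbon_graph (partial_petrial G A)"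
  using assms
  unfolding one_vertex_ribbon_graph_def one_vertex_ribbon_graph_axioms_def ribbon_graph_def
    partial_petrial_def segs_at_def
  by auto

text \<open>
  An edge \<open>{e, f}\<close> of the intersection graph only says that one of \<open>e\<close>, \<open>f\<close> is interlaced with the
  other; symmetry of interlacement removes the ambiguity.
\<close>

lemma interlaced_iff_of_complete_tripartite:
  assumes "one_vertex_ribbon_graph G" "is_complete_tripartite (intersection_graph G) l m n"
  obtains X Y Z where "edges G = X \<union> Y \<union> Z" "finite (X \<union> Y \<union> Z)"
    "X \<inter> Y = {}" "X \<inter> Z = {}" "Y \<inter> Z = {}" "card X = l" "card Y = m" "card Z = n"
    "\<forall>e\<in>edges G. \<forall>f\<in>edges G. interlaced G e f \<longleftrightarrow>
       e \<in> X \<and> f \<in> Y \<union> Z \<or> e \<in> Y \<and> f \<in> X \<union> Z \<or> e \<in> Z \<and> f \<in> X \<union> Y"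
proof -
  interpret one_vertex_ribbon_graph G by fact
  let ?I = "{{e, f} | e f. e \<in> edges G \<and> f \<in> edges G \<and> e \<noteq> f \<and> interlaced G e f}"
  obtain X Y Z where fin: "finite X" "finite Y" "finite Z"
    and card: "card X = l" "card Y = m" "card Z = n"
    and disj: "X \<inter> Y = {}" "X \<inter> Z = {}" "Y \<inter> Z = {}"
    and H: "intersection_graph G = (X \<union> Y \<union> Z, {{x, y} | x y. x \<in> X \<and> y \<in> Y} \<union> {{x, z} | x z. x \<in> X \<and> z \<in> Z} \<union>
          {{y, z} | y z. y \<in> Y \<and> z \<in> Z})"
    using assms(2) unfolding is_complete_tripartite_def by blast
  note parts = H[unfolded intersection_graph_def prod.inject]
  note E = conjunct1[OF parts] and I = conjunct2[OF parts]
  have "interlaced G e f \<longleftrightarrow>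
       e \<in> X \<and> f \<in> Y \<union> Z \<or> e \<in> Y \<and> f \<in> X \<union> Z \<or> e \<in> Z \<and> f \<in> X \<union> Y"
    if ef: "e \<in> edges G" "f \<in> edges G" for e f
  proof (cases "e = f")
    case True
    then show ?thesis using not_interlaced_self[of f] disj by auto
  next
    case False
    have "interlaced G e f \<longleftrightarrow> {e, f} \<in> ?I"
      using ef False interlaced_sym[of f e] by (auto simp: doubleton_eq_iff)
    also have "\<dots> \<longleftrightarrow> e \<in> X \<and> f \<in> Y \<union> Z \<or> e \<in> Y \<and> f \<in> X \<union> Z \<or> e \<in> Z \<and> f \<in> X \<union> Y"
      unfolding I by (auto simp: doubleton_eq_iff)
    finally show ?thesis .
  qed
  then show ?thesis using that[of X Y Z] fin card disj E by simp
qed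

theorem corollary4p3:
  fixes B :: "('v, 'e, 'h) pre_ribbon_graph" and i :: nat and z :: "int poly"
  defines "z \<equiv> monom 1 1"
  assumes "i \<ge> 2"
    and "bouquet B"
    and "card (edges B) = 3 * i"
    and "is_complete_tripartite (intersection_graph B) i i i"
  shows "partial_petrial_poly B =
    (if odd i
     then z ^ (3 * i - 2) + 3 * z ^ (2 * i) * ((1 + z) ^ i - z ^ i)
        + 3 * z ^ (i + 2) * ((1 + z) ^ i - z ^ i) ^ 2 + z ^ 2 * ((1 + z) ^ i - z ^ i) ^ 3
     else z ^ (3 * i) + 3 * z ^ (2 * i) * ((1 + z) ^ i - z ^ i)
        + 3 * z ^ (i + 2) * ((1 + z) ^ i - z ^ i) ^ 2 + z ^ 2 * ((1 + z) ^ i - z ^ i) ^ 3)"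
proof -
  have "edges B \<noteq> {}" using assms(2,4) by auto
  then have B: "one_vertex_ribbon_graph B"
    using assms(3)
    by (simp add: bouquet_def one_vertex_ribbon_graph_def one_vertex_ribbon_graph_axioms_def)
  obtain X Y Z where E: "edges B = X \<union> Y \<union> Z" and fin: "finite (X \<union> Y \<union> Z)"
    and disj: "X \<inter> Y = {}" "X \<inter> Z = {}" "Y \<inter> Z = {}"
    and card: "card X = i" "card Y = i" "card Z = i"
    and adj: "\<forall>e\<in>edges B. \<forall>f\<in>edges B. interlaced B e f \<longleftrightarrow>
       e \<in> X \<and> f \<in> Y \<union> Z \<or> e \<in> Y \<and> f \<in> X \<union> Z \<or> e \<in> Z \<and> f \<in> X \<union> Y"
    by (rule interlaced_iff_of_complete_tripartite[OF B assms(5)])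
  let ?rank = "tripartite_rank i X Y Z"
  let ?T = "\<lambda>A. sym_diff (twisted B) A"
  have twisted: "twisted B \<subseteq> edges B"
    using B by (simp add: one_vertex_ribbon_graph_def ribbon_graph_def)
  have genus: "euler_genus (partial_petrial B A) = int (?rank (?T A))" if A: "A \<subseteq> edges B" for A
  proof -
    let ?G = "partial_petrial B A"
    interpret G: one_vertex_ribbon_graph ?G
      using B A by (rule one_vertex_partial_petrial)
    have data: "edges ?G = X \<union> Y \<union> Z" "twisted ?G = ?T A"
      using E by (simp_all add: partial_petrial_def)
    have "null_space (edges ?G) (twisted_interlacement ?G)
        = null_space (X \<union> Y \<union> Z) (looped_tripartite X Y Z (?T A))"
      unfolding data
      by (rule null_space_cong)
        (use adj E in \<open>auto simp: twisted_interlacement_def looped_tripartite_def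
          interlaced_partial_petrial data\<close>)
    moreover have "?T A \<subseteq> X \<union> Y \<union> Z" using A twisted E by blast
    moreover have "card (edges ?G) = 3 * i"
      using assms(4) by (simp add: partial_petrial_def)
    ultimately show ?thesis
      using tripartite_rank_nullity[OF fin disj card] assms(2) by (intro G.euler_genus_eq_rank) simp
  qed
  have monom: "monom 1 n = z ^ n" for n
    unfolding z_def by (simp add: monom_power)
  have "partial_petrial_poly B = (\<Sum>A\<in>Pow (edges B). z ^ ?rank (?T A))"
    unfolding partial_petrial_poly_def by (rule sum.cong) (simp_all add: genus monom)
  also have "\<dots> = (\<Sum>T\<in>Pow (edges B). z ^ ?rank T)"
    \<comment> \<open>the symmetric difference with a fixed set is an involution on the subsets of ribbons\<close>
    by (rule sum.reindex_bij_witness[where i = ?T and j = ?T]) (use twisted in \<open>auto simp: Un_Diff Diff_Diff_Int\<close>)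
  also have "\<dots> = z ^ (if odd i then 3 * i - 2 else 3 * i) + 3 * z ^ (2 * i) * ((1 + z) ^ i - z ^ i)
      + 3 * z ^ (i + 2) * ((1 + z) ^ i - z ^ i) ^ 2 + z ^ 2 * ((1 + z) ^ i - z ^ i) ^ 3"
    unfolding E by (rule sum_power_tripartite_rank[OF fin disj card])
  finally show ?thesis by simp
qed

end
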